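(* Let $S(\tau,t)$ be a random service process in discrete time, let $\varepsilon\in(0,1]$, $\rho\in(0,1/\varepsilon]$, and let $\theta(\tau,t)>0$ be arbitrary (deterministic) parameters for $t\ge\tau\ge 0$. Define $$\mathcal{S}^{\varepsilon}(\tau,t)=-\frac{1}{\theta(\tau,t)}\Bigl(\ln \mathsf{E}\bigl[e^{-\theta(\tau,t)S(\tau,t)}\bigr]+\rho(t-\tau)-\ln(\rho\varepsilon)\Bigr),\qquad t\ge\tau\ge 0.$$ Then for all $t\ge 0$ $$\mathsf{P}\bigl[S(\tau,t)\ge\mathcal{S}^{\varepsilon}(\tau,t)\ \ \forall\tau\in[0,t]\bigr]\ge 1-\varepsilon.$$ Consequently $\mathcal{S}^\varepsilon$ is a non-stationary service curve: for every system whose arrivals $A$ and departures $D$ satisfy $D(t)\ge\inf_{\tau\in[0,t]}\{A(\tau)+S(\tau,t)\}$ for all $t\ge0$, it holds that $\mathsf{P}\bigl[D(t)\ge\inf_{\tau\in[0,t]}\{A(\tau)+\mathcal{S}^{\varepsilon}(\tau,t)\}\bigr]\ge 1-\varepsilon$ for all $t\ge0$.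
   Context: Time is discrete: $\tau,t$ are non-negative integers and $[0,t]$ denotes $\{0,1,\dots,t\}$. A random service process $S(\tau,t)$, $t\ge\tau\ge0$, is a family of non-negative real random variables on a common probability space with $S(t,t)=0$ for all $t\ge0$; no stationarity or independence is assumed. Cumulative arrivals $A(t)$ are non-negative, non-decreasing with $A(0)=0$ (possibly random), and $D(t)$ denotes the cumulative departures. *)

theory Defs
  imports "HOL-Probability.Probability"
begin

text \<open>Bivariate processes are indexed by all pairs of naturals, but only the values at
  pairs with \<open>\<tau> \<le> t\<close> are constrained or used.\<close>

locale random_service_process = prob_space M
  for M :: "'a measure" and S :: "nat \<Rightarrow> nat \<Rightarrow> 'a \<Rightarrow> real" +
  assumes service_measurable: "\<And>\<tau> t. \<tau> \<le> t \<Longrightarrow> S \<tau> t \<in> borel_measurable M"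
    and service_nonneg: "\<And>\<tau> t \<omega>. \<tau> \<le> t \<Longrightarrow> \<omega> \<in> space M \<Longrightarrow> 0 \<le> S \<tau> t \<omega>"
    and service_diag: "\<And>t \<omega>. \<omega> \<in> space M \<Longrightarrow> S t t \<omega> = 0"

locale arrival_process = prob_space M
  for M :: "'a measure" and A :: "nat \<Rightarrow> 'a \<Rightarrow> real" +
  assumes arrival_measurable: "\<And>t. A t \<in> borel_measurable M"
    and arrival_nonneg: "\<And>t \<omega>. \<omega> \<in> space M \<Longrightarrow> 0 \<le> A t \<omega>"
    and arrival_mono: "\<And>\<omega>. \<omega> \<in> space M \<Longrightarrow> mono (\<lambda>t. A t \<omega>)"
    and arrival_zero: "\<And>\<omega>. \<omega> \<in> space M \<Longrightarrow> A 0 \<omega> = 0"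

text \<open>The infima below range over finite non-empty sets of reals, so the real-valued \<open>INF\<close>
  is the true infimum (a minimum).\<close>

definition dynamic_server ::
  "'a measure \<Rightarrow> (nat \<Rightarrow> nat \<Rightarrow> 'a \<Rightarrow> real) \<Rightarrow> (nat \<Rightarrow> 'a \<Rightarrow> real) \<Rightarrow> (nat \<Rightarrow> 'a \<Rightarrow> real) \<Rightarrow> bool"
  where "dynamic_server M S A D \<longleftrightarrow>
    (\<forall>t. \<forall>\<omega>\<in>space M. D t \<omega> \<ge> (INF \<tau>\<in>{0..t}. A \<tau> \<omega> + S \<tau> t \<omega>))"

definition nonstationary_service_curve ::
  "'a measure \<Rightarrow> real \<Rightarrow> (nat \<Rightarrow> nat \<Rightarrow> real) \<Rightarrow> (nat \<Rightarrow> 'a \<Rightarrow> real) \<Rightarrow> (nat \<Rightarrow> 'a \<Rightarrow> real) \<Rightarrow> bool"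
  where "nonstationary_service_curve M \<epsilon> C A D \<longleftrightarrow>
    (\<forall>t. \<P>(\<omega> in M. D t \<omega> \<ge> (INF \<tau>\<in>{0..t}. A \<tau> \<omega> + C \<tau> t)) \<ge> 1 - \<epsilon>)"

definition eps_service_curve ::
  "'a measure \<Rightarrow> (nat \<Rightarrow> nat \<Rightarrow> 'a \<Rightarrow> real) \<Rightarrow> (nat \<Rightarrow> nat \<Rightarrow> real) \<Rightarrow> real \<Rightarrow> real \<Rightarrow> nat \<Rightarrow> nat \<Rightarrow> real"
  where "eps_service_curve M S \<theta> \<rho> \<epsilon> \<tau> t =
    - (1 / \<theta> \<tau> t) *
      (ln (\<integral>\<omega>. exp (- \<theta> \<tau> t * S \<tau> t \<omega>) \<partial>M) + \<rho> * (real t - real \<tau>) - ln (\<rho> * \<epsilon>))"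

end

theory Submission imports Defs begin

text \<open>Chernoff's bound gives \<open>P[S(\<tau>,t) < C(\<tau>,t)] \<le> \<rho> \<epsilon> exp(-\<rho>(t-\<tau>))\<close> for each \<open>\<tau>\<close>, where \<open>C\<close> is the
  curve. The union bound only needs \<open>\<tau> < t\<close>: at \<open>\<tau> = t\<close> the curve is \<open>ln(\<rho> \<epsilon>) / \<theta>(t,t) \<le> 0\<close>, so there
  is no violation. This saves the term that would push the geometric sum above \<open>\<epsilon>\<close>.\<close>

text \<open>Raising \<open>t\<close> by one multiplies each old summand by \<open>exp (- r)\<close>
  and adds one new summand, so the sums obey \<open>a (Suc t) = exp (- r) * (a t + r)\<close>. The
  bound 1 survives this recursion because \<open>1 + r \<le> exp r\<close>.\<close>

lemma sum_exp_decay_le_one: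
  fixes r :: real
  assumes "0 \<le> r"
  shows "(\<Sum>s<t. r * exp (- r * (real t - real s))) \<le> 1"
proof (induction t)
  case 0
  then show ?case by simp
next
  case (Suc t)
  have "(\<Sum>s<Suc t. r * exp (- r * (real (Suc t) - real s)))
      = exp (- r) * (\<Sum>s<Suc t. r * exp (- r * (real t - real s)))"
    unfolding sum_distrib_left
    by (intro sum.cong refl) (simp add: mult_exp_exp algebra_simps flip: exp_add)
  also have "\<dots> = exp (- r) * ((\<Sum>s<t. r * exp (- r * (real t - real s))) + r)"
    by simp
  also have "\<dots> \<le> exp (- r) * (1 + r)"
    using Suc by (intro mult_left_mono) auto
  also have "\<dots> \<le> exp (- r) * exp r"
    by (intro mult_left_mono exp_ge_add_one_self) auto
  finally show ?case by (simp flip: exp_add)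
qed

text \<open>The infimum is attained, the index set being finite and non-empty. This form serves both
  the outcome-wise comparison and measurability.\<close>

lemma INF_atMost_le_iff:
  fixes f :: "nat \<Rightarrow> real"
  shows "(INF s\<in>{0..t}. f s) \<le> x \<longleftrightarrow> (\<exists>s\<in>{0..t}. f s \<le> x)"
  by (subst cInf_eq_Min) (auto simp: Min_le_iff)

context random_service_process
begin

text \<open>Nonnegative service keeps the exponential in (0,1]. Integrability rules out the default
  value 0 of the integral, so the logarithm in the curve is genuine.\<close>

lemma integrable_exp_service:
  assumes "s \<le> t" "0 \<le> c"
  shows "integrable M (\<lambda>\<omega>. exp (- c * S s t \<omega>))"
  using service_measurable[OF assms(1)] service_nonneg[OF assms(1)] assms(2)
  by (intro integrable_const_bound[where B = 1] AE_I2) auto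

lemma expectation_exp_service_pos:
  assumes "s \<le> t" "0 \<le> c"
  shows "0 < (\<integral>\<omega>. exp (- c * S s t \<omega>) \<partial>M)"
  using integrable_exp_service[OF assms] by (intro expectation_greater AE_I2) auto

lemma prob_service_less_curve:
  assumes "s \<le> t" "0 < \<theta> s t" "0 < \<rho>" "0 < \<epsilon>"
  shows "\<P>(\<omega> in M. S s t \<omega> < eps_service_curve M S \<theta> \<rho> \<epsilon> s t)
    \<le> \<epsilon> * (\<rho> * exp (- \<rho> * (real t - real s)))"
proof -
  let ?c = "\<theta> s t"
  let ?C = "eps_service_curve M S \<theta> \<rho> \<epsilon> s t"
  let ?L = "\<integral>\<omega>. exp (- ?c * S s t \<omega>) \<partial>M"
  have int: "integrable M (\<lambda>\<omega>. exp (- ?c * S s t \<omega>))"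
    using integrable_exp_service assms by simp
  have L: "0 < ?L"
    using expectation_exp_service_pos assms by simp
  have [measurable]: "S s t \<in> borel_measurable M"
    by (rule service_measurable) fact
  have "\<P>(\<omega> in M. S s t \<omega> < ?C) \<le> \<P>(\<omega> in M. S s t \<omega> \<le> ?C)"
    by (intro finite_measure_mono) auto
  \<comment> \<open>Chernoff's inequality is stated with set integrals; it is applied to the whole
    space.\<close>
  also have "\<dots> \<le> exp (?c * ?C) * ?L"
    using Chernoff_ineq_le[of ?c "space M" "S s t" ?C] assms
      integrable_mult_indicator[OF sets.top int]
    unfolding set_integral_space[OF int] set_integrable_def by simp
  \<comment> \<open>The curve is chosen so that \<open>- ln ?L\<close> cancels the factor
    \<open>?L\<close>, whose positivity makes \<open>exp (ln ?L) = ?L\<close>.\<close>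
  also have "?c * ?C = - ln ?L - \<rho> * (real t - real s) + ln (\<rho> * \<epsilon>)"
    using assms by (simp add: eps_service_curve_def field_simps)
  also have "exp \<dots> * ?L = \<epsilon> * (\<rho> * exp (- \<rho> * (real t - real s)))"
    using L assms by (simp add: exp_add exp_diff exp_minus field_simps)
  finally show ?thesis .
qed

text \<open>As \<open>S t t\<close> vanishes, the expectation is 1 and its logarithm 0; only
  \<open>ln (\<rho> * \<epsilon>) / \<theta> t t\<close> remains.\<close>

lemma eps_service_curve_diag_nonpos:
  assumes "0 < \<theta> t t" "0 < \<rho>" "0 < \<epsilon>" "\<rho> * \<epsilon> \<le> 1"
  shows "eps_service_curve M S \<theta> \<rho> \<epsilon> t t \<le> 0"
proof -
  have "(\<integral>\<omega>. exp (- \<theta> t t * S t t \<omega>) \<partial>M) = (\<integral>\<omega>. 1 \<partial>M)"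
    by (intro Bochner_Integration.integral_cong) (auto simp: service_diag)
  then show ?thesis
    using assms by (simp add: eps_service_curve_def prob_space divide_le_0_iff)
qed

lemma prob_service_ge_curve:
  assumes "0 < \<epsilon>" "0 < \<rho>" "\<rho> * \<epsilon> \<le> 1" "\<And>s. s \<le> t \<Longrightarrow> 0 < \<theta> s t"
  shows "1 - \<epsilon> \<le> \<P>(\<omega> in M. \<forall>s\<in>{0..t}. eps_service_curve M S \<theta> \<rho> \<epsilon> s t \<le> S s t \<omega>)"
proof -
  let ?C = "\<lambda>s. eps_service_curve M S \<theta> \<rho> \<epsilon> s t"
  let ?G = "{\<omega> \<in> space M. \<forall>s\<in>{0..t}. ?C s \<le> S s t \<omega>}"
  let ?B = "\<lambda>s. {\<omega> \<in> space M. S s t \<omega> < ?C s}"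
  have meas: "s \<le> t \<Longrightarrow> S s t \<in> borel_measurable M" for s
    by (rule service_measurable)
  have B: "?B s \<in> events" if "s \<le> t" for s
    using meas[OF that] by measurable
  have G: "?G \<in> events"
    using meas by (intro sets.sets_Collect_finite_All') auto
  have "?C t \<le> S t t \<omega>" if "\<omega> \<in> space M" for \<omega>
    using eps_service_curve_diag_nonpos[of \<theta> t] assms that by (simp add: service_diag)
  \<comment> \<open>A violating index cannot be \<open>t\<close>, so it lies strictly below.\<close>
  then have "space M - ?G \<subseteq> (\<Union>s<t. ?B s)"
    by (force simp: not_le order_le_less)
  then have "prob (space M - ?G) \<le> prob (\<Union>s<t. ?B s)"
    using B by (intro finite_measure_mono sets.finite_UN) auto
  also have "\<dots> \<le> (\<Sum>s<t. prob (?B s))"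
    using B by (intro finite_measure_subadditive_finite) auto
  also have "\<dots> \<le> (\<Sum>s<t. \<epsilon> * (\<rho> * exp (- \<rho> * (real t - real s))))"
    using assms by (intro sum_mono prob_service_less_curve) auto
  also have "\<dots> = \<epsilon> * (\<Sum>s<t. \<rho> * exp (- \<rho> * (real t - real s)))"
    by (simp add: sum_distrib_left)
  also have "\<dots> \<le> \<epsilon>"
    using sum_exp_decay_le_one[of \<rho> t] assms mult_left_mono[of _ 1 \<epsilon>] by simp
  finally show ?thesis
    using prob_compl[OF G] by simp
qed

text \<open>The transfer is outcome by outcome: an index \<open>s\<close> with
  \<open>A s \<omega> + S s t \<omega> \<le> D t \<omega>\<close> also witnesses the bound with
  \<open>C s t\<close> in place of the service.\<close>

lemma nonstationary_service_curveI:
  assumes A: "arrival_process M A" and D: "\<And>t. D t \<in> borel_measurable M"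
    and server: "dynamic_server M S A D"
    and C: "\<And>t. 1 - \<epsilon> \<le> \<P>(\<omega> in M. \<forall>s\<in>{0..t}. C s t \<le> S s t \<omega>)"
  shows "nonstationary_service_curve M \<epsilon> C A D"
  unfolding nonstationary_service_curve_def
proof
  fix t
  note [measurable] = D arrival_process.arrival_measurable[OF A]
  have "(INF s\<in>{0..t}. A s \<omega> + C s t) \<le> D t \<omega>"
    if \<omega>: "\<omega> \<in> space M" and le: "\<forall>s\<in>{0..t}. C s t \<le> S s t \<omega>" for \<omega>
  proof -
    have "(INF s\<in>{0..t}. A s \<omega> + S s t \<omega>) \<le> D t \<omega>"
      using server \<omega> by (simp add: dynamic_server_def)
    then show ?thesis
      using le unfolding INF_atMost_le_iff by force
  qed
  \<comment> \<open>Monotonicity of probability needs the larger event to be measurable: a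
    non-measurable set has measure 0 by default.\<close>
  moreover have "{\<omega> \<in> space M. (INF s\<in>{0..t}. A s \<omega> + C s t) \<le> D t \<omega>} \<in> events"
    unfolding INF_atMost_le_iff by measurable
  ultimately have "\<P>(\<omega> in M. \<forall>s\<in>{0..t}. C s t \<le> S s t \<omega>)
      \<le> \<P>(\<omega> in M. (INF s\<in>{0..t}. A s \<omega> + C s t) \<le> D t \<omega>)"
    by (intro finite_measure_mono) auto
  with C[of t] show "1 - \<epsilon> \<le> \<P>(\<omega> in M. (INF s\<in>{0..t}. A s \<omega> + C s t) \<le> D t \<omega>)"
    by linarith
qed

end

theorem mainTheorem4:
  fixes M :: "'a measure"
    and S :: "nat \<Rightarrow> nat \<Rightarrow> 'a \<Rightarrow> real"
    and \<theta> :: "nat \<Rightarrow> nat \<Rightarrow> real"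
    and \<epsilon> \<rho> :: real
  assumes "random_service_process M S"
    and "0 < \<epsilon>" and "\<epsilon> \<le> 1"
    and "0 < \<rho>" and "\<rho> \<le> 1 / \<epsilon>"
    and "\<And>\<tau> t. \<tau> \<le> t \<Longrightarrow> 0 < \<theta> \<tau> t"
  shows "(\<forall>t. \<P>(\<omega> in M. \<forall>\<tau>\<in>{0..t}. S \<tau> t \<omega> \<ge> eps_service_curve M S \<theta> \<rho> \<epsilon> \<tau> t) \<ge> 1 - \<epsilon>)
    \<and> (\<forall>A D. arrival_process M A \<longrightarrow> (\<forall>t. D t \<in> borel_measurable M) \<longrightarrow> dynamic_server M S A D
         \<longrightarrow> nonstationary_service_curve M \<epsilon> (eps_service_curve M S \<theta> \<rho> \<epsilon>) A D)"
proof -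
  interpret random_service_process M S by fact
  \<comment> \<open>This is the form of the bound on \<rho> that fixes the sign of the curve on the
    diagonal.\<close>
  have "\<rho> * \<epsilon> \<le> 1"
    using assms by (simp add: pos_le_divide_eq)
  then have *: "1 - \<epsilon> \<le> \<P>(\<omega> in M. \<forall>\<tau>\<in>{0..t}. eps_service_curve M S \<theta> \<rho> \<epsilon> \<tau> t \<le> S \<tau> t \<omega>)" for t
    using assms by (intro prob_service_ge_curve) auto
  then show ?thesis
    using nonstationary_service_curveI by blast
qed

end
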